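(* For any positive integers $n$ and $L\le\sqrt{n/2}$ with $L$ divisible by $4$, there exists a bipartite graph $G=(C\cup S,E)$ with $|C|=n$ and $\mathrm{opt}(G)=L$, together with an ordering in which the clients of $C$ are inserted, such that any algorithm for the exact online assignment problem requires a total of $\Omega(nL)$ changes to its assignment. This holds even if the algorithm knows the entire graph $G$ and the insertion order in advance.
   Context: An assignment $\mathcal A: C\to S$ maps each client $c$ to a neighboring server. The load $\ell_{\mathcal A}(s)$ is the number of clients assigned to $s$, $\ell(\mathcal A)=\max_{s\in S}\ell_{\mathcal A}(s)$, and $\mathrm{opt}(G)$ is the minimum of $\ell(\mathcal A)$ over all assignments. In the exact online assignment problem, clients are inserted one by one with all their incident edges; letting $G_t$ be the graph after $t$ clients have arrived and $\mathcal A_t$ the algorithm's assignment at that time, the algorithm must ensure $\ell(\mathcal A_t)=\mathrm{opt}(G_t)$ for all $t$. A change is the reassignment of one client (changing which server it is assigned to). *)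

theory Defs
  imports Complex_Main
begin

text \<open>
  A bipartite graph between clients and servers; an edge \<open>(c, s)\<close> joins client \<open>c\<close> and server \<open>s\<close>.
\<close>

record 'v bigraph =
  clients :: "'v set"
  servers :: "'v set"
  edges :: "('v \<times> 'v) set"

definition bipartite_graph :: "'v bigraph \<Rightarrow> bool" where
  "bipartite_graph G \<longleftrightarrow>
     finite (clients G) \<and> finite (servers G) \<and> clients G \<inter> servers G = {} \<and>
     edges G \<subseteq> clients G \<times> servers G"

text \<open>
  Only the values of \<open>A\<close> on \<open>clients G\<close> matter; they are arbitrary elsewhere.
\<close>

definition is_assignment :: "'v bigraph \<Rightarrow> ('v \<Rightarrow> 'v) \<Rightarrow> bool" where
  "is_assignment G A \<longleftrightarrow> (\<forall>c\<in>clients G. (c, A c) \<in> edges G)"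

definition load :: "'v bigraph \<Rightarrow> ('v \<Rightarrow> 'v) \<Rightarrow> 'v \<Rightarrow> nat" where
  "load G A s = card {c \<in> clients G. A c = s}"

definition max_load :: "'v bigraph \<Rightarrow> ('v \<Rightarrow> 'v) \<Rightarrow> nat" where
  "max_load G A = Max (load G A ` servers G)"

text \<open>
  The value is meaningful only if \<open>G\<close> has an assignment, i.e. if every client has a neighbour,
  and has at least one server.
\<close>

definition opt :: "'v bigraph \<Rightarrow> nat" where
  "opt G = (LEAST k. \<exists>A. is_assignment G A \<and> max_load G A = k)"

text \<open>
  An insertion order is a list enumerating the clients; all servers are present from the start.
\<close>

definition insertion_order :: "'v bigraph \<Rightarrow> 'v list \<Rightarrow> bool" where
  "insertion_order G cs \<longleftrightarrow> distinct cs \<and> set cs = clients G"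

definition graph_at :: "'v bigraph \<Rightarrow> 'v list \<Rightarrow> nat \<Rightarrow> 'v bigraph" where
  "graph_at G cs t =
     \<lparr>clients = set (take t cs), servers = servers G,
      edges = {(c, s) \<in> edges G. c \<in> set (take t cs)}\<rparr>"

text \<open>
  A run of an exact algorithm is its sequence of assignments. Nothing is required of how
  \<open>A t\<close> is computed, so it may depend on all of \<open>G\<close> and \<open>cs\<close>.
\<close>

definition exact_run :: "'v bigraph \<Rightarrow> 'v list \<Rightarrow> (nat \<Rightarrow> 'v \<Rightarrow> 'v) \<Rightarrow> bool" where
  "exact_run G cs A \<longleftrightarrow>
     (\<forall>t\<le>length cs. is_assignment (graph_at G cs t) (A t) \<and>
        max_load (graph_at G cs t) (A t) = opt (graph_at G cs t))"

text \<open>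
  The first assignment of a newly inserted client is not a change: step \<open>t\<close> to \<open>Suc t\<close> counts
  only clients already present at time \<open>t\<close>.
\<close>

definition total_changes :: "'v list \<Rightarrow> (nat \<Rightarrow> 'v \<Rightarrow> 'v) \<Rightarrow> nat" where
  "total_changes cs A = (\<Sum>t<length cs. card {c \<in> set (take t cs). A t c \<noteq> A (Suc t) c})"

end

theory Submission
  imports Defs
begin

text \<open>
  Put \<open>h = L/2\<close> and take \<open>M = 2 h m\<close> servers in a path, with \<open>m = n div L\<^sup>2\<close>. First every server
  \<open>x\<close> receives \<open>h\<close> mobile clients, each of which may use \<open>x\<close> or \<open>x + 1\<close>. Then \<open>h\<close> rows of \<open>M\<close>
  pinned clients follow. The path is cut into blocks of length \<open>h\<close>; even rows put two clients on
  every server of the even blocks, odd rows do the same on the odd blocks. After \<open>k\<close> rows in total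
  the optimum is \<open>k\<close> and all path servers are full, so the load equations, read from left to right,
  determine how many mobile clients of \<open>x\<close> sit on \<open>x + 1\<close>: none if \<open>k\<close> is even, and a triangular
  wave of height \<open>h\<close> in \<open>x\<close> if \<open>k\<close> is odd. Hence each of the \<open>h\<close> pinned rows costs
  \<open>m h\<^sup>2\<close> changes, the sum of this wave. Clients beyond the first \<open>M L\<close> get private servers.
\<close>

section \<open>Counting in rows\<close>

lemma card_rows_Suc:
  fixes M k :: nat
  shows "card {c. c < Suc k * M \<and> P c} = card {c. c < k * M \<and> P c} + card {x. x < M \<and> P (k * M + x)}"
proof -
  have "{c. c < Suc k * M \<and> P c} = {c. c < k * M \<and> P c} \<union> (+) (k * M) ` {x. x < M \<and> P (k * M + x)}"
    by (auto simp: image_iff) (metis add_less_cancel_left le_add_diff_inverse linorder_not_le add.commute)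
  moreover have "{c. c < k * M \<and> P c} \<inter> (+) (k * M) ` {x. x < M \<and> P (k * M + x)} = {}"
    by auto
  ultimately show ?thesis
    by (simp add: card_Un_disjoint card_image)
qed

text \<open>Double counting: with clients numbered \<open>\<rho> * M + x\<close>, each row is added
  to all columns at once. This lets per-server bounds on mobile clients be summed along the
  path.\<close>

lemma card_rows_by_columns:
  fixes M k :: nat
  shows "card {c. c < k * M \<and> P c} = (\<Sum>x<M. card {\<rho>. \<rho> < k \<and> P (\<rho> * M + x)})"
proof (induction k)
  case 0
  then show ?case by simp
next
  case (Suc k)
  have col: "card {\<rho>. \<rho> < Suc k \<and> P (\<rho> * M + x)}
      = card {\<rho>. \<rho> < k \<and> P (\<rho> * M + x)} + of_bool (P (k * M + x))" for x
  proof -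
    have "{\<rho>. \<rho> < Suc k \<and> P (\<rho> * M + x)}
        = {\<rho>. \<rho> < k \<and> P (\<rho> * M + x)} \<union> (if P (k * M + x) then {k} else {})"
      by (auto simp: less_Suc_eq)
    then show ?thesis
      by (simp add: card_Un_disjoint)
  qed
  have "card {x. x < M \<and> P (k * M + x)} = (\<Sum>x<M. of_bool (P (k * M + x)))"
    by (simp add: of_bool_def sum.If_cases Int_def)
  then show ?case
    unfolding card_rows_Suc col sum.distrib Suc.IH by simp
qed

section \<open>Changes and optimal loads\<close>

text \<open>A client whose server differs at the two ends must have moved in some step in between.
  Presence of \<open>H\<close> from time \<open>a\<close> on makes each such move count as a change
  rather than a first assignment.\<close>

lemma card_differ_le_sum_changes:
  assumes "a \<le> b" and "finite H" and "\<And>t. a \<le> t \<Longrightarrow> H \<subseteq> set (take t cs)"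
  shows "card {c \<in> H. A a c \<noteq> A b c} \<le> (\<Sum>t=a..<b. card {c \<in> set (take t cs). A t c \<noteq> A (Suc t) c})"
  using \<open>a \<le> b\<close>
proof (induction b rule: dec_induct)
  case base
  then show ?case by simp
next
  case (step b)
  have "{c \<in> H. A a c \<noteq> A (Suc b) c}
      \<subseteq> {c \<in> H. A a c \<noteq> A b c} \<union> {c \<in> set (take b cs). A b c \<noteq> A (Suc b) c}"
    using assms(3)[of b] step.hyps by auto
  then have "card {c \<in> H. A a c \<noteq> A (Suc b) c}
      \<le> card {c \<in> H. A a c \<noteq> A b c} + card {c \<in> set (take b cs). A b c \<noteq> A (Suc b) c}"
    using \<open>finite H\<close> by (intro order_trans[OF card_mono card_Un_le]) auto
  then show ?case
    using step.IH step.hyps by simp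
qed

lemma opt_le:
  "is_assignment G A \<Longrightarrow> max_load G A \<le> k \<Longrightarrow> opt G \<le> k"
  unfolding opt_def by (rule order_trans[OF Least_le]) auto

lemma opt_attained:
  assumes "is_assignment G A"
  obtains B where "is_assignment G B" and "max_load G B = opt G"
proof -
  have "\<exists>B. is_assignment G B \<and> max_load G B = opt G"
    unfolding opt_def by (rule LeastI_ex) (use assms in blast)
  then show thesis
    using that by blast
qed

section \<open>The hard instance\<close>

text \<open>\<open>n_ge\<close> says that \<open>2 * h\<close> rows of \<open>M = 2 * h * m\<close>
  clients fit among the \<open>n\<close> clients. Evenness of \<open>h\<close> makes the first
  pinned row an even one.\<close>

locale path_instance =
  fixes h m n :: nat
  assumes h_pos: "0 < h" and h_even: "even h" and m_pos: "0 < m" and n_ge: "2 * h * (2 * h * m) \<le> n"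
begin

definition M :: nat where
  "M = 2 * h * m"

text \<open>The test \<open>x mod (2 * h) < h\<close> recognises an even block. Clients at an index
  of the wrong parity are folded by \<open>h\<close> onto the neighbouring block, so every receiving
  server gets two.\<close>

definition pinned :: "nat \<Rightarrow> nat \<Rightarrow> nat" where
  "pinned \<rho> x =
     (if even \<rho> then (if x mod (2 * h) < h then x else x - h)
      else (if x mod (2 * h) < h then x + h else x))"

text \<open>Clients are numbered in order of insertion; path server \<open>x\<close> is the vertex \<open>n + x\<close>.\<close>

definition nbrs :: "nat \<Rightarrow> nat set" where
  "nbrs c =
     (if c < h * M then {n + c mod M, n + min (Suc (c mod M)) (M - 1)}
      else if c < 2 * h * M then {n + pinned (c div M) (c mod M)}
      else {n + c})"

definition G :: "nat bigraph" where
  "G = \<lparr>clients = {..<n}, servers = {n..<2 * n}, edges = {(c, s). c < n \<and> s \<in> nbrs c}\<rparr>"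

text \<open>Depends on \<open>\<rho>\<close> through its parity alone, so \<open>pins 0\<close>
  later stands for any even row.\<close>

definition pins :: "nat \<Rightarrow> nat \<Rightarrow> nat" where
  "pins \<rho> s = (if even \<rho> \<longleftrightarrow> s mod (2 * h) < h then 2 else 0)"

text \<open>Over one period the values are 1, ..., \<open>h\<close>, \<open>h\<close> - 1, ..., 0.
  The peak equals the number of mobile clients per server, so the wave can be realised.\<close>

definition wave :: "nat \<Rightarrow> nat" where
  "wave x = (if x mod (2 * h) < h then x mod (2 * h) + 1 else 2 * h - 1 - x mod (2 * h))"

text \<open>If \<open>A\<close> respects \<open>nbrs\<close>, these are the mobile clients of
  \<open>x\<close> sitting on the right neighbour: the flow across the path edge after
  \<open>x\<close>.\<close>

definition shifted :: "(nat \<Rightarrow> nat) \<Rightarrow> nat \<Rightarrow> nat" where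
  "shifted A x = card {\<rho>. \<rho> < h \<and> A (\<rho> * M + x) \<noteq> n + x}"

lemma M_pos: "0 < M"
  using h_pos m_pos by (simp add: M_def)

lemma rows_le_n: "k \<le> 2 * h \<Longrightarrow> k * M \<le> n"
  using n_ge mult_le_mono1[of k "2 * h" M] unfolding M_def by (rule order_trans[rotated])

lemma mobile_index_less:
  assumes "\<rho> < h" and "x < M"
  shows "\<rho> * M + x < h * M"
proof -
  have "\<rho> * M + x < Suc \<rho> * M" using assms by simp
  also have "\<dots> \<le> h * M" using assms by (intro mult_le_mono1) simp
  finally show ?thesis .
qed

lemma M_le_n: "M \<le> n"
  using rows_le_n[of 1] h_pos by simp

section \<open>Block arithmetic and loads of pinned rows\<close>

lemma block_add:
  assumes "s mod (2 * h) < h"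
  shows "(s + h) mod (2 * h) = s mod (2 * h) + h"
proof -
  have "(s + h) mod (2 * h) = (s mod (2 * h) + h) mod (2 * h)"
    by (simp add: mod_add_left_eq)
  then show ?thesis
    using assms by simp
qed

lemma block_diff:
  assumes "\<not> s mod (2 * h) < h"
  shows "h \<le> s" and "(s - h) mod (2 * h) = s mod (2 * h) - h"
proof -
  have le: "s mod (2 * h) \<le> s" by simp
  then show "h \<le> s" using assms by linarith
  have "s - h = s div (2 * h) * (2 * h) + (s mod (2 * h) - h)"
    using assms div_mult_mod_eq[of s "2 * h"] by linarith
  moreover have "s mod (2 * h) - h < 2 * h"
    using h_pos mod_less_divisor[of "2 * h" s] by linarith
  ultimately show "(s - h) mod (2 * h) = s mod (2 * h) - h"
    by (metis mod_less mod_mult_self3)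
qed

text \<open>\<open>M\<close> is a multiple of \<open>2 * h\<close>, so the path ends with a complete
  odd block.\<close>

lemma block_add_less_M:
  assumes "s < M" and "s mod (2 * h) < h"
  shows "s + h < M"
proof -
  have "s div (2 * h) < m"
    using assms(1) by (simp add: M_def less_mult_imp_div_less mult.commute)
  then have "(s div (2 * h) + 1) * (2 * h) \<le> m * (2 * h)"
    by (intro mult_le_mono1) simp
  then show ?thesis
    using assms(2) div_mult_mod_eq[of s "2 * h"] by (simp add: M_def algebra_simps)
qed

lemma pinned_less: "x < M \<Longrightarrow> pinned \<rho> x < M"
  using block_add_less_M by (auto simp: pinned_def)

text \<open>A receiving server has itself and its partner at distance \<open>h\<close> as preimages;
  the other servers have none.\<close>

lemma card_pinned:
  assumes "s < M"
  shows "card {x. x < M \<and> pinned \<rho> x = s} = pins \<rho> s"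
proof (cases "even \<rho>")
  case True
  show ?thesis
  proof (cases "s mod (2 * h) < h")
    case low: True
    have "{x. x < M \<and> pinned \<rho> x = s} = {s, s + h}"
      using True low assms block_add_less_M[of s] block_add[of s] block_diff h_pos
      by (auto simp: pinned_def split: if_splits)
    then show ?thesis
      using True low h_pos by (simp add: pins_def)
  next
    case high: False
    have "pinned \<rho> x \<noteq> s" if "x < M" for x
    proof -
      have "x mod (2 * h) - h < h"
        using h_pos mod_less_divisor[of "2 * h" x] by linarith
      then show ?thesis
        using True high block_diff[of x] by (auto simp: pinned_def)
    qed
    then show ?thesis
      using True high by (simp add: pins_def)
  qed
next
  case False
  show ?thesis
  proof (cases "s mod (2 * h) < h")
    case low: True
    have "pinned \<rho> x \<noteq> s" if "x < M" for x
      using False low block_add[of x] h_pos by (auto simp: pinned_def split: if_splits)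
    then show ?thesis
      using False low by (simp add: pins_def)
  next
    case high: False
    have "(s - h) mod (2 * h) < h"
      using block_diff(2)[OF high] mod_less_divisor[of "2 * h" s] h_pos by linarith
    then have "{x. x < M \<and> pinned \<rho> x = s} = {s, s - h}"
      using False high assms block_diff[OF high] h_pos
      by (auto simp: pinned_def split: if_splits)
    then show ?thesis
      using False high h_pos block_diff(1)[OF high] by (simp add: pins_def)
  qed
qed

section \<open>The triangular wave\<close>

lemma wave_le: "wave x \<le> h"
  by (auto simp: wave_def)

lemma wave_0: "wave 0 = 1"
  using h_pos by (simp add: wave_def)

lemma wave_last: "wave (M - 1) = 0"
proof -
  have "M - 1 = (m - 1) * (2 * h) + (2 * h - 1)"
  proof -
    obtain m' where "m = Suc m'" using m_pos gr0_conv_Suc by auto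
    then show ?thesis using h_pos unfolding M_def by (simp add: mult.commute)
  qed
  then have "(M - 1) mod (2 * h) = 2 * h - 1"
    using h_pos by (metis diff_less mod_less mod_mult_self3 mult_pos_pos zero_less_numeral zero_less_one)
  then show ?thesis
    using h_pos by (auto simp: wave_def)
qed

text \<open>This is the flow balance at \<open>Suc x\<close> with one unmatched even row: the slope
  is +1 in even blocks and -1 in odd ones.\<close>

lemma wave_Suc: "wave (Suc x) + 1 = wave x + pins 0 (Suc x)"
proof -
  have "x mod (2 * h) < 2 * h" using h_pos by simp
  then show ?thesis
    using h_pos unfolding wave_def pins_def mod_Suc by (auto simp del: mod_less_divisor; linarith)
qed

lemma sum_wave: "(\<Sum>x<M. wave x) = m * h ^ 2"
proof -
  \<comment> \<open>The rising and the falling half of a period add up termwise to the constant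
    \<open>j\<close>.\<close>
  have low: "(\<Sum>x<j. x + 1) + (\<Sum>x<j. j - 1 - x) = j ^ 2" for j :: nat
  proof -
    have "(\<Sum>x<j. x + 1) + (\<Sum>x<j. j - 1 - x) = (\<Sum>x<j. j)"
      unfolding sum.distrib[symmetric] by (intro sum.cong) auto
    then show ?thesis
      by (simp add: power2_eq_square)
  qed
  have period: "(\<Sum>x=j * (2 * h)..<j * (2 * h) + 2 * h. wave x) = h ^ 2" for j
  proof -
    have "wave (x + j * (2 * h)) = wave x" for x
      by (simp only: wave_def mod_mult_self1)
    then have "(\<Sum>x=j * (2 * h)..<j * (2 * h) + 2 * h. wave x) = (\<Sum>x<2 * h. wave x)"
      using sum.shift_bounds_nat_ivl[of wave 0 "j * (2 * h)" "2 * h"]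
      by (simp only: add_0 atLeast0LessThan add.commute[of "j * (2 * h)"])
    also have "\<dots> = (\<Sum>x<h. wave x) + (\<Sum>x<h. wave (x + h))"
      using sum.nat_group[of wave h 2] sum.shift_bounds_nat_ivl[of wave 0 h h]
      by (simp add: numeral_2_eq_2 atLeast0LessThan mult.commute)
    also have "\<dots> = (\<Sum>x<h. x + 1) + (\<Sum>x<h. h - 1 - x)"
      by (intro arg_cong2[where f = "(+)"] sum.cong) (auto simp: wave_def)
    finally show ?thesis
      using low by simp
  qed
  have "(\<Sum>x<M. wave x) = (\<Sum>j<m. \<Sum>x=j * (2 * h)..<j * (2 * h) + 2 * h. wave x)"
    by (simp add: sum.nat_group M_def mult.commute)
  then show ?thesis
    by (simp add: period)
qed

section \<open>Load equations along the path\<close>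

text \<open>The \<open>min\<close> in \<open>nbrs\<close> makes both choices coincide at the last
  path server, so nothing flows out of the path.\<close>

lemma shifted_last:
  assumes "\<forall>c<k * M. A c \<in> nbrs c" and "h \<le> k"
  shows "shifted A (M - 1) = 0"
proof -
  have "A (\<rho> * M + (M - 1)) = n + (M - 1)" if "\<rho> < h" for \<rho>
  proof -
    define c where "c = \<rho> * M + (M - 1)"
    have c: "c < h * M"
      unfolding c_def using that M_pos by (intro mobile_index_less) auto
    have "c mod M = M - 1"
      unfolding c_def mod_mult_self3 using M_pos by simp
    then have "nbrs c = {n + (M - 1)}"
      using c by (simp add: nbrs_def)
    moreover have "c < k * M"
      using c mult_le_mono1[OF assms(2), of M] by linarith
    ultimately show ?thesis
      using assms(1) unfolding c_def by blast
  qed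
  then show ?thesis
    by (auto simp: shifted_def)
qed

text \<open>Conservation of flow: what arrives from the left neighbour and what leaves to the right
  change the initial \<open>h\<close>. The additive form avoids truncated subtraction.\<close>

lemma mobile_load:
  assumes valid: "\<forall>c<h * M. A c \<in> nbrs c" and "s < M"
  shows "card {c. c < h * M \<and> A c = n + s} + shifted A s = h + (if s = 0 then 0 else shifted A (s - 1))"
proof -
  have nb: "A (\<rho> * M + x) \<in> {n + x, n + min (Suc x) (M - 1)}" if "\<rho> < h" "x < M" for \<rho> x
    using valid that mobile_index_less[OF that] by (auto simp: nbrs_def)
  define f where "f x = card {\<rho>. \<rho> < h \<and> A (\<rho> * M + x) = n + s}" for x
  have own: "f s + shifted A s = h"
  proof -
    have "f s + shifted A s = card ({\<rho>. \<rho> < h \<and> A (\<rho> * M + s) = n + s} \<union> {\<rho>. \<rho> < h \<and> A (\<rho> * M + s) \<noteq> n + s})"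
      unfolding f_def shifted_def by (subst card_Un_disjoint) auto
    also have "\<dots> = card {..<h}"
      by (intro arg_cong[where f = card]) auto
    finally show ?thesis by simp
  qed
  have prev: "f x = shifted A x" if "s = Suc x" for x
    unfolding f_def shifted_def
    using nb[of _ x] that \<open>s < M\<close> by (intro arg_cong[where f = card]) (fastforce simp: min_def)
  have zero: "f x = 0" if "x < M" "x \<noteq> s" "s = 0 \<or> x \<noteq> s - 1" for x
    using nb[of _ x] that unfolding f_def by (force simp: min_def split: if_splits)
  have "card {c. c < h * M \<and> A c = n + s} = (\<Sum>x<M. f x)"
    unfolding f_def by (rule card_rows_by_columns)
  also have "\<dots> = (\<Sum>x\<in>(if s = 0 then {s} else {s - 1, s}). f x)"
    using \<open>s < M\<close> zero by (intro sum.mono_neutral_right) (auto split: if_splits)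
  finally show ?thesis
    using own prev[of "s - 1"] by (cases s) auto
qed

text \<open>An even row followed by an odd row puts exactly two clients on every server, so the
  pinned load is uniform except for one unmatched even row when \<open>k\<close> is odd.\<close>

lemma path_load:
  assumes "h \<le> k" and "k \<le> 2 * h" and "\<forall>c<k * M. A c \<in> nbrs c" and "s < M"
  shows "card {c. c < k * M \<and> A c = n + s} + shifted A s
    = (if s = 0 then 0 else shifted A (s - 1)) + (if even k then k else k - 1 + pins 0 s)"
  using assms(1-3)
proof (induction k rule: dec_induct)
  case base
  then show ?case
    using mobile_load[OF _ \<open>s < M\<close>] h_even by simp
next
  case (step k)
  have le: "k * M \<le> Suc k * M" by simp
  have "A (k * M + x) = n + pinned k x" if "x < M" for x
  proof -
    have "k * M + x < Suc k * M" using that by simp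
    moreover have "Suc k * M \<le> 2 * h * M"
      using step.prems(1) by (rule mult_le_mono1)
    moreover have "\<not> k * M + x < h * M"
      using mult_le_mono1[OF step.hyps(1), of M] by linarith
    moreover have "(k * M + x) div M = k" "(k * M + x) mod M = x"
      using that by auto
    ultimately have "nbrs (k * M + x) = {n + pinned k x}"
      unfolding nbrs_def by (simp only: if_False if_True order_less_le_trans)
    then show ?thesis
      using step.prems(2) \<open>k * M + x < Suc k * M\<close> by blast
  qed
  then have "{x. x < M \<and> A (k * M + x) = n + s} = {x. x < M \<and> pinned k x = s}"
    by auto
  then have row: "card {x. x < M \<and> A (k * M + x) = n + s} = pins k s"
    using card_pinned \<open>s < M\<close> by simp
  have "card {c. c < k * M \<and> A c = n + s} + shifted A s
    = (if s = 0 then 0 else shifted A (s - 1)) + (if even k then k else k - 1 + pins 0 s)"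
    using step.IH step.prems le by (meson Suc_leD order_less_le_trans)
  moreover have "(if even k then k else k - 1 + pins 0 s) + pins k s
      = (if even (Suc k) then Suc k else Suc k - 1 + pins 0 s)"
    using step.hyps h_pos by (auto simp: pins_def)
  ultimately show ?case
    unfolding card_rows_Suc row by simp
qed

section \<open>Positions forced on the mobile clients by optimal loads\<close>

context
  fixes k :: nat and A :: "nat \<Rightarrow> nat"
  assumes k: "h \<le> k" "k \<le> 2 * h" and valid: "\<forall>c<k * M. A c \<in> nbrs c"
    and le: "\<And>s. s < M \<Longrightarrow> card {c. c < k * M \<and> A c = n + s} \<le> k"
begin

text \<open>With uniform pinned load, the cap \<open>k\<close> makes the flow nondecreasing to the
  right, while it is 0 at the last server.\<close>

lemma shifted_even:
  assumes "even k" and "x < M"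
  shows "shifted A x = 0"
proof -
  have mono: "shifted A x \<le> shifted A (Suc x)" if "Suc x < M" for x
    using path_load[OF k valid that] le[OF that] \<open>even k\<close> by simp
  have "x \<le> M - 1" using assms by simp
  then have "shifted A x \<le> shifted A (M - 1)"
  proof (induction rule: inc_induct)
    case (step j)
    then show ?case
      using mono[of j] by linarith
  qed simp
  then show ?thesis
    using shifted_last[OF valid k(1)] by simp
qed

text \<open>The cap turns the load equation into the recurrence of \<open>wave_Suc\<close> with an
  inequality, solved from left to right.\<close>

lemma shifted_odd:
  assumes "odd k" and "x < M"
  shows "wave x \<le> shifted A x"
  using \<open>x < M\<close>
proof (induction x)
  \<comment> \<open>Server 0 gets nothing from the left but two clients of the unmatched even row,
    so at least one mobile client must leave.\<close>
  case 0
  then show ?case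
    using path_load[OF k valid 0] le[OF 0] \<open>odd k\<close> h_pos k wave_0 by (simp add: pins_def)
next
  case (Suc x)
  then have "wave x \<le> shifted A x" by simp
  then show ?case
    using path_load[OF k valid Suc.prems] le[OF Suc.prems] \<open>odd k\<close> k h_pos wave_Suc[of x] by simp
qed

end

section \<open>An assignment with all path loads equal\<close>

text \<open>For odd \<open>k\<close> the mobile clients of \<open>x\<close> in the first
  \<open>wave x\<close> rows move right; this realises the wave exactly.\<close>

definition balanced :: "nat \<Rightarrow> nat \<Rightarrow> nat" where
  "balanced k c =
     (if c < h * M then n + (if odd k \<and> c div M < wave (c mod M) then Suc (c mod M) else c mod M)
      else if c < 2 * h * M then n + pinned (c div M) (c mod M)
      else n + c)"

lemma balanced_nbrs: "balanced k c \<in> nbrs c"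
proof -
  \<comment> \<open>No client of the last server is asked to move, since the wave vanishes
    there.\<close>
  have "Suc (c mod M) \<le> M - 1" if "c div M < wave (c mod M)"
  proof -
    have "c mod M \<noteq> M - 1"
      using that wave_last by auto
    then show ?thesis
      using mod_less_divisor[OF M_pos, of c] by linarith
  qed
  then show ?thesis
    by (auto simp: balanced_def nbrs_def)
qed

lemma shifted_balanced:
  assumes "x < M"
  shows "shifted (balanced k) x = (if odd k then wave x else 0)"
proof -
  have "balanced k (\<rho> * M + x) \<noteq> n + x \<longleftrightarrow> odd k \<and> \<rho> < wave x" if "\<rho> < h" for \<rho>
    using mobile_index_less[OF that assms] assms by (simp add: balanced_def)
  then have "{\<rho>. \<rho> < h \<and> balanced k (\<rho> * M + x) \<noteq> n + x} = (if odd k then {..<wave x} else {})"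
    using wave_le[of x] by (auto dest: order_less_le_trans)
  then show ?thesis
    by (simp add: shifted_def)
qed

lemma balanced_path_load:
  assumes k: "h \<le> k" "k \<le> 2 * h" and "s < M"
  shows "card {c. c < k * M \<and> balanced k c = n + s} = k"
proof (cases s)
  case 0
  then show ?thesis
    using path_load[of k "balanced k" s] assms balanced_nbrs shifted_balanced wave_0 h_pos
    by (auto simp: pins_def split: if_splits)
next
  case (Suc x)
  then show ?thesis
    using path_load[of k "balanced k" s] assms balanced_nbrs shifted_balanced wave_Suc[of x] h_pos
    by (auto split: if_splits)
qed

section \<open>Translation to the graphs during insertion\<close>

lemma nbrs_path: "c < 2 * h * M \<Longrightarrow> nbrs c \<subseteq> {n..<n + M}"
  using mod_less_divisor[OF M_pos, of c] pinned_less by (auto simp: nbrs_def min_def)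

lemma nbrs_servers:
  assumes "c < n"
  shows "nbrs c \<subseteq> {n..<2 * n}"
proof (cases "c < 2 * h * M")
  case True
  then show ?thesis
    using nbrs_path[OF True] M_le_n by fastforce
next
  case False
  moreover have "\<not> c < h * M"
    using False by linarith
  ultimately show ?thesis
    using assms by (auto simp: nbrs_def)
qed

lemma nbrs_not_path:
  assumes "\<not> c < 2 * h * M"
  shows "nbrs c = {n + c}" and "M \<le> c"
proof -
  have "\<not> c < h * M" using assms by linarith
  then show "nbrs c = {n + c}" using assms by (simp add: nbrs_def)
  have "1 * M \<le> 2 * h * M" using h_pos by (intro mult_le_mono1) simp
  then show "M \<le> c" using assms by linarith
qed

lemma bipartite_G: "bipartite_graph G"
  using nbrs_servers by (auto simp: bipartite_graph_def G_def)

lemma graph_at_G: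
  assumes "t \<le> n"
  shows "graph_at G [0..<n] t = \<lparr>clients = {..<t}, servers = {n..<2 * n}, edges = {(c, s). c < t \<and> s \<in> nbrs c}\<rparr>"
  using assms by (auto simp: graph_at_def G_def take_upt)

lemma graph_at_G_n: "graph_at G [0..<n] n = G"
  by (subst graph_at_G) (simp_all add: G_def)

lemma is_assignment_at:
  "t \<le> n \<Longrightarrow> is_assignment (graph_at G [0..<n] t) A \<longleftrightarrow> (\<forall>c<t. A c \<in> nbrs c)"
  by (auto simp: graph_at_G is_assignment_def)

lemma load_at: "t \<le> n \<Longrightarrow> load (graph_at G [0..<n] t) A s = card {c. c < t \<and> A c = s}"
  by (simp add: graph_at_G load_def)

lemma max_load_at_le_iff:
  assumes "t \<le> n"
  shows "max_load (graph_at G [0..<n] t) A \<le> K \<longleftrightarrow> (\<forall>s\<in>{n..<2 * n}. card {c. c < t \<and> A c = s} \<le> K)"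
proof -
  have "0 < n" using M_pos M_le_n by simp
  then have "max_load (graph_at G [0..<n] t) A = Max ((\<lambda>s. card {c. c < t \<and> A c = s}) ` {n..<2 * n})"
    using assms by (simp add: max_load_def load_at[symmetric] graph_at_G)
  then show ?thesis
    using \<open>0 < n\<close> by simp
qed

section \<open>Optimal loads\<close>

text \<open>The second alternative for \<open>t\<close> covers the final graph, in which the private
  clients are present too.\<close>

lemma balanced_max_load:
  assumes k: "h \<le> k" "k \<le> 2 * h" and t: "t = k * M \<or> k = 2 * h \<and> t = n"
  shows "max_load (graph_at G [0..<n] t) (balanced k) \<le> k"
proof -
  have kM: "k * M \<le> 2 * h * M" using k(2) by (rule mult_le_mono1)
  have tn: "t \<le> n" using t rows_le_n k by auto
  have "card {c. c < t \<and> balanced k c = s} \<le> k" if s: "s \<in> {n..<2 * n}" for s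
  proof (cases "s < n + M")
    case True
    \<comment> \<open>Immediate if \<open>t = k * M\<close>; at \<open>t = n\<close> the later
      clients sit on private servers beyond the path.\<close>
    have "c < k * M" if "c < t" "balanced k c = s" for c
      using t that nbrs_not_path[of c] balanced_nbrs[of k c] True
      by (cases "c < 2 * h * M") auto
    moreover have "k * M \<le> t"
      using t rows_le_n k by auto
    ultimately have "{c. c < t \<and> balanced k c = s} = {c. c < k * M \<and> balanced k c = n + (s - n)}"
      using s by auto
    moreover have "s - n < M"
      using True s by auto
    ultimately show ?thesis
      using balanced_path_load[OF k, of "s - n"] by (metis order_refl)
  next
    case False
    have "{c. c < t \<and> balanced k c = s} \<subseteq> {s - n}"
    proof
      fix c assume c: "c \<in> {c. c < t \<and> balanced k c = s}"
      then have "\<not> c < 2 * h * M"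
        using nbrs_path[of c] balanced_nbrs[of k c] False by fastforce
      then show "c \<in> {s - n}"
        using nbrs_not_path(1)[of c] balanced_nbrs[of k c] c by auto
    qed
    then have "card {c. c < t \<and> balanced k c = s} \<le> 1"
      using card_mono[of "{s - n}"] by fastforce
    then show ?thesis
      using k h_pos by simp
  qed
  then show ?thesis
    using max_load_at_le_iff[OF tn] by blast
qed

text \<open>This bound caps all loads of an exact run after \<open>k\<close> rows, as
  \<open>shifted_even\<close> and \<open>shifted_odd\<close> require.\<close>

lemma opt_at_le:
  assumes "h \<le> k" "k \<le> 2 * h"
  shows "opt (graph_at G [0..<n] (k * M)) \<le> k"
  using assms by (intro opt_le[where A = "balanced k"]) (auto simp: is_assignment_at rows_le_n balanced_nbrs intro: balanced_max_load)

lemma opt_G: "opt G = 2 * h"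
proof (rule antisym)
  have asg: "is_assignment G (balanced (2 * h))"
    using is_assignment_at[of n] balanced_nbrs by (simp add: graph_at_G_n)
  then show le: "opt G \<le> 2 * h"
    using balanced_max_load[of "2 * h" n] by (intro opt_le) (auto simp: graph_at_G_n)
  obtain B where B: "is_assignment G B" "max_load G B = opt G"
    using opt_attained[OF asg] .
  have kn: "2 * h * M \<le> n" by (rule rows_le_n) simp
  have valid: "\<forall>c<2 * h * M. B c \<in> nbrs c"
    using is_assignment_at[of n B] B(1) kn by (auto simp: graph_at_G_n)
  have load: "card {c. c < 2 * h * M \<and> B c = n + s} \<le> opt G" if "s < M" for s
  proof -
    have "card {c. c < 2 * h * M \<and> B c = n + s} \<le> card {c. c < n \<and> B c = n + s}"
      using kn by (intro card_mono) auto
    also have "\<dots> \<le> opt G"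
      using max_load_at_le_iff[of n B "opt G"] B(2) that M_le_n by (simp add: graph_at_G_n)
    finally show ?thesis .
  qed
  \<comment> \<open>An optimal \<open>B\<close> has loads at most \<open>2 * h\<close>, so no mobile
    client moves; the load equation then makes server 0 carry exactly \<open>2 * h\<close>.\<close>
  have "shifted B 0 = 0"
    using shifted_even[of "2 * h" B 0] valid load le M_pos by force
  then show "2 * h \<le> opt G"
    using path_load[of "2 * h" B 0] valid M_pos load[OF M_pos] by simp
qed

section \<open>Counting the changes\<close>

text \<open>One of \<open>k\<close> and \<open>Suc k\<close> is even, with all mobile clients at
  home; the other is odd, with at least a wave of them away. Each client away has changed, whichever
  state comes first.\<close>

lemma changes_per_row:
  assumes run: "exact_run G [0..<n] A" and k: "h \<le> k" "k < 2 * h"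
  shows "m * h ^ 2 \<le> card {c \<in> {..<h * M}. A (k * M) c \<noteq> A (Suc k * M) c}"
proof -
  have exact: "(\<forall>c<j * M. A (j * M) c \<in> nbrs c) \<and>
      (\<forall>s<M. card {c. c < j * M \<and> A (j * M) c = n + s} \<le> j)" if j: "h \<le> j" "j \<le> 2 * h" for j
  proof -
    have jn: "j * M \<le> n" using j rows_le_n by simp
    then have "is_assignment (graph_at G [0..<n] (j * M)) (A (j * M))"
      and "max_load (graph_at G [0..<n] (j * M)) (A (j * M)) \<le> j"
      using run opt_at_le[OF j] by (auto simp: exact_run_def)
    then show ?thesis
      using is_assignment_at[OF jn] max_load_at_le_iff[OF jn] M_le_n by auto
  qed
  have even0: "shifted (A (j * M)) x = 0" if "h \<le> j" "j \<le> 2 * h" "even j" "x < M" for j x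
    using shifted_even[of j "A (j * M)" x] exact[of j] that by blast
  have odd_ge: "wave x \<le> shifted (A (j * M)) x" if "h \<le> j" "j \<le> 2 * h" "odd j" "x < M" for j x
    using shifted_odd[of j "A (j * M)" x] exact[of j] that by blast
  have column: "wave x \<le> card {\<rho>. \<rho> < h \<and> A (k * M) (\<rho> * M + x) \<noteq> A (Suc k * M) (\<rho> * M + x)}"
    if x: "x < M" for x
  proof -
    obtain i j where ij: "{i, j} = {k, Suc k}" "even i" "odd j"
      by (metis even_Suc insert_commute)
    then have bounds: "h \<le> i" "i \<le> 2 * h" "h \<le> j" "j \<le> 2 * h"
      using k by (auto simp: doubleton_eq_iff)
    have "A (i * M) (\<rho> * M + x) = n + x" if "\<rho> < h" for \<rho>
      using even0[OF bounds(1,2) ij(2) x] that by (auto simp: shifted_def)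
    then have "shifted (A (j * M)) x
        \<le> card {\<rho>. \<rho> < h \<and> A (k * M) (\<rho> * M + x) \<noteq> A (Suc k * M) (\<rho> * M + x)}"
      unfolding shifted_def using ij(1) by (intro card_mono) (fastforce simp: doubleton_eq_iff)+
    then show ?thesis
      using odd_ge[OF bounds(3,4) ij(3) x] by linarith
  qed
  have "m * h ^ 2 \<le> (\<Sum>x<M. card {\<rho>. \<rho> < h \<and> A (k * M) (\<rho> * M + x) \<noteq> A (Suc k * M) (\<rho> * M + x)})"
    unfolding sum_wave[symmetric] using column by (intro sum_mono) simp
  then show ?thesis
    using card_rows_by_columns[of h M "\<lambda>c. A (k * M) c \<noteq> A (Suc k * M) c"] by simp
qed

lemma total_changes_ge:
  assumes run: "exact_run G [0..<n] A"
  shows "m * h ^ 3 \<le> total_changes [0..<n] A"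
proof -
  define \<delta> where "\<delta> t = card {c \<in> set (take t [0..<n]). A t c \<noteq> A (Suc t) c}" for t
  have row: "m * h ^ 2 \<le> (\<Sum>t=k * M..<k * M + M. \<delta> t)" if k: "k \<in> {h..<2 * h}" for k
  proof -
    \<comment> \<open>All mobile clients precede row \<open>k\<close>, since
      \<open>h \<le> k\<close>; times beyond \<open>n\<close> are included, where
      \<open>take\<close> returns the whole list.\<close>
    have "{..<h * M} \<subseteq> set (take t [0..<n])" if "k * M \<le> t" for t
    proof -
      have "h * M \<le> k * M" using k by simp
      moreover have "h * M \<le> n" by (rule rows_le_n) simp
      moreover have "set (take t [0..<n]) = {..<min t n}"
        by (cases "t \<le> n") (auto simp: take_upt)
      ultimately show ?thesis
        using that by (metis lessThan_subset_iff min.boundedI order_trans)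
    qed
    then have "card {c \<in> {..<h * M}. A (k * M) c \<noteq> A (k * M + M) c} \<le> (\<Sum>t=k * M..<k * M + M. \<delta> t)"
      unfolding \<delta>_def by (intro card_differ_le_sum_changes) auto
    then show ?thesis
      using changes_per_row[OF run, of k] k by (simp add: add.commute)
  qed
  have "m * h ^ 3 = (\<Sum>k=h..<2 * h. m * h ^ 2)"
    by (simp add: power3_eq_cube power2_eq_square)
  also have "\<dots> \<le> (\<Sum>k=h..<2 * h. \<Sum>t=k * M..<k * M + M. \<delta> t)"
    using row by (rule sum_mono)
  \<comment> \<open>Adding the mobile rows makes the time windows tile an initial segment.\<close>
  also have "\<dots> \<le> (\<Sum>k<2 * h. \<Sum>t=k * M..<k * M + M. \<delta> t)"
    by (intro sum_mono2) auto
  also have "\<dots> = (\<Sum>t<2 * h * M. \<delta> t)"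
    by (rule sum.nat_group)
  also have "\<dots> \<le> (\<Sum>t<n. \<delta> t)"
    using rows_le_n[of "2 * h"] by (intro sum_mono2) auto
  finally show ?thesis
    by (simp add: total_changes_def \<delta>_def)
qed

end

section \<open>Choice of the parameters\<close>

theorem theorem4:
  "\<exists>\<kappa>::real. \<kappa> > 0 \<and>
     (\<forall>(n::nat) (L::nat). n > 0 \<longrightarrow> L > 0 \<longrightarrow> real L \<le> sqrt (real n / 2) \<longrightarrow> 4 dvd L \<longrightarrow>
       (\<exists>(G :: nat bigraph) (cs :: nat list).
          bipartite_graph G \<and> (\<forall>c\<in>clients G. \<exists>s\<in>servers G. (c, s) \<in> edges G) \<and>
          card (clients G) = n \<and> opt G = L \<and> insertion_order G cs \<and>
          (\<forall>A. exact_run G cs A \<longrightarrow> real (total_changes cs A) \<ge> \<kappa> * real n * real L)))"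
proof (intro exI[of _ "1 / 16 :: real"] conjI allI impI)
  fix n L :: nat
  assume "n > 0" "L > 0" and sq: "real L \<le> sqrt (real n / 2)" and "4 dvd L"
  define h where "h = L div 2"
  have L: "L = 2 * h" and "even h" "0 < h"
    using \<open>4 dvd L\<close> \<open>L > 0\<close> by (auto simp: h_def elim!: dvdE)
  define m where "m = n div L ^ 2"
  have "real L ^ 2 \<le> real n / 2"
    using power_mono[OF sq, of 2] by simp
  then have "real (L ^ 2) \<le> real n"
    unfolding of_nat_power by linarith
  then have "L ^ 2 \<le> n"
    by (simp only: of_nat_le_iff)
  then have "0 < m"
    using \<open>L > 0\<close> by (simp add: m_def div_greater_zero_iff)
  have "L ^ 2 * m \<le> n"
    by (simp add: m_def)
  then interpret path_instance h m n
    using \<open>even h\<close> \<open>0 < h\<close> \<open>0 < m\<close> by unfold_locales (simp_all add: L power2_eq_square mult.assoc)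
  \<comment> \<open>Rounding down in \<open>m\<close> loses at most a factor 2, because
    \<open>m\<close> is positive. With \<open>L = 2 * h\<close> the constant becomes 2 * 8 =
    16.\<close>
  have "n < L ^ 2 * Suc m"
    unfolding m_def using \<open>L > 0\<close> by (simp add: dividend_less_times_div)
  also have "\<dots> \<le> L ^ 2 * (2 * m)"
    using \<open>0 < m\<close> by (intro mult_le_mono2) simp
  finally have "n * L \<le> L ^ 2 * (2 * m) * L"
    by simp
  then have bound: "n * L \<le> 16 * (m * h ^ 3)"
    by (simp add: L power2_eq_square power3_eq_cube algebra_simps)
  show "\<exists>(G :: nat bigraph) cs. bipartite_graph G \<and> (\<forall>c\<in>clients G. \<exists>s\<in>servers G. (c, s) \<in> edges G) \<and>
      card (clients G) = n \<and> opt G = L \<and> insertion_order G cs \<and>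
      (\<forall>A. exact_run G cs A \<longrightarrow> real (total_changes cs A) \<ge> 1 / 16 * real n * real L)"
  proof (intro exI[of _ G] exI[of _ "[0..<n]"] conjI allI impI)
    show "\<forall>c\<in>clients G. \<exists>s\<in>servers G. (c, s) \<in> edges G"
      using balanced_nbrs nbrs_servers by (fastforce simp: G_def)
    fix A
    assume "exact_run G [0..<n] A"
    then have "n * L \<le> 16 * total_changes [0..<n] A"
      using total_changes_ge[of A] bound by linarith
    then have "real (n * L) \<le> real (16 * total_changes [0..<n] A)"
      by (simp only: of_nat_le_iff)
    then show "real (total_changes [0..<n] A) \<ge> 1 / 16 * real n * real L"
      by simp
  qed (use bipartite_G opt_G L in \<open>auto simp: insertion_order_def G_def\<close>)
qed simp

end
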